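(* Let $D=\{(x_i,y_i):i\in[m]\}\subset\mathcal{X}\times\{+1,-1\}$ be an arbitrary dataset of size $m$ with positive label ratio $r>0$. Suppose that $\nu$ and $\mu$ satisfy $0<\mu<\nu<1$, $\nu m,\mu m\in\mathbb{N}$, and $\mu<r/2$. For a non-negative integer $\ell$, assume $$0\le 2\left(\mu-\frac{\ell}{m}\right)<\nu-\mu<2(r-2\mu).$$ Then $$\sup\{\,|b_{D'}|\,:\,D'\in\mathcal{D}_{\mu m-\ell}\,\}<\infty,$$ where $\mathcal{D}_{\mu m-\ell}$ is the family of contaminated datasets defined from $D$ and $b_{D'}$ is the bias parameter estimated by robust $(\nu,\mu)$-SVM from $D'$.
   Context: Let $\mathcal{X}$ be a (nonempty) input space and $\mathcal{H}$ a reproducing kernel Hilbert space (RKHS) of real functions on $\mathcal{X}$ with kernel $k:\mathcal{X}^2\to\mathbb{R}$ (not assumed bounded) and norm $\|\cdot\|_{\mathcal{H}}$. Write $[m]=\{1,\ldots,m\}$ and $[z]_+=\max\{z,0\}$. A dataset of size $m$ is a collection $D=\{(x_i,y_i):i\in[m]\}$ of labeled points of $\mathcal{X}\times\{+1,-1\}$ (repetitions are allowed and counted with multiplicity). Its label ratio is $$r=\frac1m\min\{\,|\{i:y_i=+1\}|,\ |\{i:y_i=-1\}|\,\}.$$ For a dataset $D$ of size $m$ and an integer $0\le\kappa\le m$, the family of contaminated datasets is $$\mathcal{D}_\kappa=\{D'=\{(x_i',y_i'):i\in[m]\}\subset\mathcal{X}\times\{+1,-1\}\,:\,|D'\cap D|\ge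 m-\kappa\},$$ i.e. all datasets of size $m$ having at least $m-\kappa$ elements in common with $D$ (equivalently, obtained from $D$ by replacing at most $\kappa$ of its samples by arbitrary labeled points). Robust $(\nu,\mu)$-SVM applied to a dataset $D=\{(x_i,y_i):i\in[m]\}$ is the optimization problem $$\min_{f,b,\rho,\eta}\ \frac12\|f\|_{\mathcal{H}}^2-(\nu-\mu)\rho+\frac1m\sum_{i=1}^m\eta_i\big[\rho-y_i(f(x_i)+b)\big]_+$$ over $f\in\mathcal{H}$, $b,\rho\in\mathbb{R}$ and $\eta=(\eta_1,\ldots,\eta_m)^T\in E_\mu$, where $$E_\mu=\Big\{\eta\in\{0,1\}^m\,:\,\sum_{i=1}^m\eta_i\ge m(1-\mu)\Big\}.$$ The pair $(f_D,b_D)\in\mathcal{H}\times\mathbb{R}$ denotes the $(f,b)$-part of a (global) optimal solution; $b_D$ is the estimated bias parameter. If the optimal solution is not unique, $b_D$ is the bias of any choice of optimal solution. *)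

theory Defs
  imports Complex_Main "HOL-Library.Multiset" "HOL-Library.FuncSet" "HOL-Library.Extended_Real"
begin

definition rkhs_norm :: "(('x \<Rightarrow> real) \<Rightarrow> ('x \<Rightarrow> real) \<Rightarrow> real) \<Rightarrow> ('x \<Rightarrow> real) \<Rightarrow> real"
  where "rkhs_norm ip f = sqrt (ip f f)"

text \<open>
  A Hilbert space of real functions on the type \<open>'x\<close> with pointwise vector operations, given by its
  carrier \<open>H\<close> and an inner product \<open>ip\<close> whose values outside \<open>H\<close> are irrelevant, and with
  reproducing kernel \<open>k\<close>.
\<close>

locale rkhs =
  fixes H :: "('x \<Rightarrow> real) set"
    and ip :: "('x \<Rightarrow> real) \<Rightarrow> ('x \<Rightarrow> real) \<Rightarrow> real"
    and k :: "'x \<Rightarrow> 'x \<Rightarrow> real"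
  assumes zero_mem: "(\<lambda>x. 0) \<in> H"
    and add_mem: "\<lbrakk>f \<in> H; g \<in> H\<rbrakk> \<Longrightarrow> (\<lambda>x. f x + g x) \<in> H"
    and scale_mem: "f \<in> H \<Longrightarrow> (\<lambda>x. c * f x) \<in> H"
    and ip_commute: "\<lbrakk>f \<in> H; g \<in> H\<rbrakk> \<Longrightarrow> ip f g = ip g f"
    and ip_add_left: "\<lbrakk>f \<in> H; g \<in> H; h \<in> H\<rbrakk> \<Longrightarrow> ip (\<lambda>x. f x + g x) h = ip f h + ip g h"
    and ip_scale_left: "\<lbrakk>f \<in> H; g \<in> H\<rbrakk> \<Longrightarrow> ip (\<lambda>x. c * f x) g = c * ip f g"
    and ip_nonneg: "f \<in> H \<Longrightarrow> 0 \<le> ip f f"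
    and ip_eq_zero: "\<lbrakk>f \<in> H; ip f f = 0\<rbrakk> \<Longrightarrow> f = (\<lambda>x. 0)"
    and complete:
      "\<lbrakk>\<And>n. F n \<in> H;
        \<And>e. 0 < e \<Longrightarrow> \<exists>N. \<forall>i\<ge>N. \<forall>j\<ge>N. rkhs_norm ip (\<lambda>x. F i x - F j x) < e\<rbrakk>
       \<Longrightarrow> \<exists>f\<in>H. (\<lambda>n. rkhs_norm ip (\<lambda>x. F n x - f x)) \<longlonglongrightarrow> 0"
    and kernel_mem: "(\<lambda>x'. k x' x) \<in> H"
    and reproducing: "f \<in> H \<Longrightarrow> f x = ip f (\<lambda>x'. k x' x)"

text \<open>
  Datasets are lists, so that samples are indexed and counted with multiplicity; indices run
  over \<open>{..<m}\<close>.
\<close>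

definition dataset :: "nat \<Rightarrow> ('x \<times> real) list \<Rightarrow> bool"
  where "dataset m D \<longleftrightarrow> length D = m \<and> (\<forall>i<m. snd (D ! i) \<in> {1, -1})"

definition label_ratio :: "('x \<times> real) list \<Rightarrow> real"
  where "label_ratio D =
    1 / real (length D) *
      real (min (card {i. i < length D \<and> snd (D ! i) = 1})
                (card {i. i < length D \<and> snd (D ! i) = -1}))"

text \<open>
  Multiset intersection makes the number of common samples respect multiplicity and
  independent of the order in which the samples are listed.
\<close>

definition contaminated :: "('x \<times> real) list \<Rightarrow> nat \<Rightarrow> ('x \<times> real) list set"
  where "contaminated D \<kappa> =
    {D'. dataset (length D) D' \<and> size (mset D' \<inter># mset D) \<ge> length D - \<kappa>}"

definition outlier_indicators :: "nat \<Rightarrow> real \<Rightarrow> (nat \<Rightarrow> real) set"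
  where "outlier_indicators m \<mu> =
    {\<eta> \<in> {..<m} \<rightarrow> {0, 1}. (\<Sum>i<m. \<eta> i) \<ge> real m * (1 - \<mu>)}"

definition robust_svm_objective ::
    "(('x \<Rightarrow> real) \<Rightarrow> ('x \<Rightarrow> real) \<Rightarrow> real) \<Rightarrow> real \<Rightarrow> real \<Rightarrow> ('x \<times> real) list
      \<Rightarrow> ('x \<Rightarrow> real) \<Rightarrow> real \<Rightarrow> real \<Rightarrow> (nat \<Rightarrow> real) \<Rightarrow> real"
  where "robust_svm_objective ip \<nu> \<mu> D f b \<rho> \<eta> =
    1 / 2 * (rkhs_norm ip f)\<^sup>2 - (\<nu> - \<mu>) * \<rho>
      + 1 / real (length D) *
          (\<Sum>i<length D. \<eta> i * max (\<rho> - snd (D ! i) * (f (fst (D ! i)) + b)) 0)"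

definition robust_svm_optimal ::
    "('x \<Rightarrow> real) set \<Rightarrow> (('x \<Rightarrow> real) \<Rightarrow> ('x \<Rightarrow> real) \<Rightarrow> real) \<Rightarrow> real \<Rightarrow> real \<Rightarrow> ('x \<times> real) list
      \<Rightarrow> ('x \<Rightarrow> real) \<Rightarrow> real \<Rightarrow> real \<Rightarrow> (nat \<Rightarrow> real) \<Rightarrow> bool"
  where "robust_svm_optimal H ip \<nu> \<mu> D f b \<rho> \<eta> \<longleftrightarrow>
    f \<in> H \<and> \<eta> \<in> outlier_indicators (length D) \<mu> \<and>
    (\<forall>f'\<in>H. \<forall>b' \<rho>'. \<forall>\<eta>'\<in>outlier_indicators (length D) \<mu>.
       robust_svm_objective ip \<nu> \<mu> D f b \<rho> \<eta> \<le> robust_svm_objective ip \<nu> \<mu> D f' b' \<rho>' \<eta>')"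

text \<open>The optimum need not be unique, so a dataset has a set of estimated biases.\<close>

definition estimated_biases ::
    "('x \<Rightarrow> real) set \<Rightarrow> (('x \<Rightarrow> real) \<Rightarrow> ('x \<Rightarrow> real) \<Rightarrow> real) \<Rightarrow> real \<Rightarrow> real \<Rightarrow> ('x \<times> real) list
      \<Rightarrow> real set"
  where "estimated_biases H ip \<nu> \<mu> D = {b. \<exists>f \<rho> \<eta>. robust_svm_optimal H ip \<nu> \<mu> D f b \<rho> \<eta>}"

end

theory Submission
  imports Defs
begin

text \<open>
  Moving \<open>(b, \<rho>)\<close> along \<open>(-s, 1)\<close> leaves the margins of class \<open>-s\<close> relative to \<open>\<rho>\<close> unchanged, so
  optimality says that, among the samples of class \<open>s\<close> with \<open>\<eta> = 1\<close>, at most \<open>(\<nu> - \<mu>) m / 2\<close> have a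
  margin below \<open>\<rho>\<close> and at least that many have a margin of at most \<open>\<rho>\<close>. By the assumptions on \<open>\<nu>\<close>,
  \<open>\<mu>\<close>, \<open>\<ell>\<close>, each class therefore has an uncontaminated sample with margin at least \<open>\<rho>\<close> and another
  one with margin at most \<open>\<rho>\<close>. If \<open>B\<close> bounds \<open>\<bar>f\<bar>\<close> on the original inputs, these four samples give
  \<open>\<bar>b\<bar> \<le> B\<close> and \<open>\<rho> \<le> B\<close>. Comparing with the zero solution,
  \<open>\<parallel>f\<parallel>\<^sup>2 / 2 \<le> (\<nu> - \<mu>) \<rho> \<le> (\<nu> - \<mu>) B\<close>; as \<open>B\<close> may be taken proportional to \<open>\<parallel>f\<parallel>\<close>, with a factor
  that depends on \<open>D\<close> only, this bounds \<open>\<parallel>f\<parallel>\<close> and hence \<open>B\<close>.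
\<close>

section \<open>Cauchy-Schwarz and point evaluations in the RKHS\<close>

lemma (in rkhs) ip_scale_add_self:
  assumes "f \<in> H" "g \<in> H"
  shows "ip (\<lambda>x. c * f x + d * g x) (\<lambda>x. c * f x + d * g x)
    = c\<^sup>2 * ip f f + 2 * c * d * ip f g + d\<^sup>2 * ip g g"
proof -
  let ?u = "\<lambda>x. c * f x" and ?v = "\<lambda>x. d * g x"
  let ?h = "\<lambda>x. ?u x + ?v x"
  have mem: "?u \<in> H" "?v \<in> H" "?h \<in> H"
    using assms by (auto intro!: scale_mem add_mem)
  have left: "ip ?h w = c * ip f w + d * ip g w" if "w \<in> H" for w
    using ip_add_left[OF mem(1,2) that] ip_scale_left[OF assms(1) that]
      ip_scale_left[OF assms(2) that] by simp
  have "ip f ?h = c * ip f f + d * ip f g" "ip g ?h = c * ip f g + d * ip g g"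
    using left[OF assms(1)] left[OF assms(2)] ip_commute[OF mem(3) assms(1)]
      ip_commute[OF mem(3) assms(2)] ip_commute[OF assms] by simp_all
  then have "ip ?h ?h = c * (c * ip f f + d * ip f g) + d * (c * ip f g + d * ip g g)"
    using left[OF mem(3)] by simp
  then show ?thesis
    by (simp only: power2_eq_square algebra_simps)
qed

lemma (in rkhs) Cauchy_Schwarz_ip:
  assumes "f \<in> H" "g \<in> H"
  shows "(ip f g)\<^sup>2 \<le> ip f f * ip g g"
proof -
  have nonneg: "0 \<le> c\<^sup>2 * ip f f + 2 * c * d * ip f g + d\<^sup>2 * ip g g" for c d
    using ip_nonneg[OF add_mem[OF scale_mem[OF assms(1)] scale_mem[OF assms(2)]]]
    by (simp only: ip_scale_add_self[OF assms])
  show ?thesis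
  proof (cases "ip g g = 0")
    case True
    then have "g = (\<lambda>x. 0 * g x)"
      using ip_eq_zero assms by simp
    then have "ip g f = 0"
      using ip_scale_left[OF assms(2,1), of 0] by simp
    then show ?thesis
      using True ip_commute assms by simp
  next
    case False
    then have pos: "0 < ip g g"
      using ip_nonneg assms(2) by fastforce
    \<comment> \<open>The ratio \<open>d / c\<close> is the minimiser of the quadratic, scaled to
      avoid a division.\<close>
    have "0 \<le> ip g g * (ip f f * ip g g - (ip f g)\<^sup>2)"
      using nonneg[of "ip g g" "- ip f g"] by (simp add: power2_eq_square algebra_simps)
    then show ?thesis
      using pos by (simp add: zero_le_mult_iff)
  qed
qed

text \<open>The kernel section at \<open>x\<close> represents evaluation and has squared norm
  \<open>k x x\<close>.\<close>

lemma (in rkhs) abs_eval_le: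
  assumes "f \<in> H"
  shows "\<bar>f x\<bar> \<le> rkhs_norm ip f * sqrt (k x x)"
proof -
  have "(f x)\<^sup>2 \<le> ip f f * k x x"
    using Cauchy_Schwarz_ip[OF assms kernel_mem[of x]] reproducing[OF assms, of x]
      reproducing[OF kernel_mem, of x x] by simp
  then have "sqrt ((f x)\<^sup>2) \<le> sqrt (ip f f * k x x)"
    by (rule real_sqrt_le_mono)
  then show ?thesis
    by (simp add: real_sqrt_mult rkhs_norm_def)
qed

section \<open>Counting by the slopes of a hinge sum\<close>

text \<open>The sum is piecewise linear in \<open>t\<close> and vanishes at 0, where the two counts
  are its left and right derivatives. A linear minorant through 0 has its slope between
  them.\<close>

lemma hinge_sum_slope_bounds:
  fixes g :: "'i \<Rightarrow> real"
  assumes "finite A" and slope: "\<And>t. c * t \<le> (\<Sum>i\<in>A. max (g i + t) 0 - max (g i) 0)"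
  shows "real (card {i \<in> A. 0 < g i}) \<le> c" and "c \<le> real (card {i \<in> A. 0 \<le> g i})"
proof -
  \<comment> \<open>Shifting by \<open>e\<close> or \<open>- e\<close> carries no nonzero
    \<open>g i\<close> past 0, so the increments are exactly linear. The inserted 1 covers the case
    that all \<open>g i\<close> vanish.\<close>
  define e where "e = Min (insert 1 ((\<lambda>i. \<bar>g i\<bar>) ` {i \<in> A. g i \<noteq> 0}))"
  have e: "0 < e" "\<And>i. i \<in> A \<Longrightarrow> g i \<noteq> 0 \<Longrightarrow> e \<le> \<bar>g i\<bar>"
    using assms(1) by (simp_all add: e_def)
  have "(\<Sum>i\<in>A. max (g i + e) 0 - max (g i) 0) = (\<Sum>i\<in>A. if 0 \<le> g i then e else 0)"
  proof (intro sum.cong)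
    fix i assume "i \<in> A"
    then have "g i = 0 \<or> e \<le> g i \<or> g i \<le> - e"
      using e(2)[of i] by linarith
    then show "max (g i + e) 0 - max (g i) 0 = (if 0 \<le> g i then e else 0)"
      using e(1) by (elim disjE) simp_all
  qed simp
  also have "\<dots> = real (card {i \<in> A. 0 \<le> g i}) * e"
    using assms(1) by (simp add: sum.If_cases Int_def)
  finally show "c \<le> real (card {i \<in> A. 0 \<le> g i})"
    using slope[of e] e(1) by simp
  have "(\<Sum>i\<in>A. max (g i + - e) 0 - max (g i) 0) = (\<Sum>i\<in>A. if 0 < g i then - e else 0)"
  proof (intro sum.cong)
    fix i assume "i \<in> A"
    then have "g i = 0 \<or> e \<le> g i \<or> g i \<le> - e"
      using e(2)[of i] by linarith
    then show "max (g i + - e) 0 - max (g i) 0 = (if 0 < g i then - e else 0)"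
      using e(1) by (elim disjE) simp_all
  qed simp
  also have "\<dots> = - (real (card {i \<in> A. 0 < g i}) * e)"
    using assms(1) by (simp add: sum.If_cases Int_def)
  finally show "real (card {i \<in> A. 0 < g i}) \<le> c"
    using slope[of "- e"] e(1) by simp
qed

section \<open>Counting samples under contamination\<close>

lemma card_nth_eq_size_filter_mset:
  "card {i. i < length xs \<and> P (xs ! i)} = size (filter_mset P (mset xs))"
  by (metis length_filter_conv_card mset_filter size_mset)

lemma contaminated_card_foreign_le:
  assumes "D' \<in> contaminated D \<kappa>"
  shows "card {i. i < length D' \<and> D' ! i \<notin> set D} \<le> \<kappa>"
proof -
  have "filter_mset (\<lambda>p. p \<notin> set D) (mset D') \<subseteq># mset D' - mset D"
  proof (rule mset_subset_eqI)
    fix p show "count (filter_mset (\<lambda>p. p \<notin> set D) (mset D')) p \<le> count (mset D' - mset D) p"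
    proof (cases "p \<in> set D")
      case False
      then have "count (mset D) p = 0"
        by simp
      then show ?thesis
        by (simp only: count_diff count_filter_mset) simp
    qed simp
  qed
  then have "size (filter_mset (\<lambda>p. p \<notin> set D) (mset D')) \<le> size (mset D' - mset D)"
    by (rule size_mset_mono)
  also have "size (mset D' - mset D) + size (mset D' \<inter># mset D) = length D'"
    by (metis diff_intersect_left_idem diff_subset_eq_self size_Diff_submset size_mset
        size_mset_mono subset_mset.inf_le1 le_add_diff_inverse2)
  then have "size (mset D' - mset D) \<le> \<kappa>"
    using assms by (auto simp: contaminated_def dataset_def)
  finally show ?thesis
    using card_nth_eq_size_filter_mset[of D' "\<lambda>p. p \<notin> set D"] by linarith
qed

text \<open>At most \<open>\<kappa>\<close> samples of \<open>D\<close> are missing from the common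
  part, and the common part consists of samples of \<open>D'\<close> that lie in
  \<open>set D\<close>.\<close>

lemma contaminated_card_class_ge:
  assumes "D' \<in> contaminated D \<kappa>"
  shows "card {i. i < length D \<and> P (D ! i)}
    \<le> card {i. i < length D' \<and> P (D' ! i) \<and> D' ! i \<in> set D} + \<kappa>"
proof -
  let ?I = "mset D' \<inter># mset D"
  have split: "mset D = ?I + (mset D - ?I)"
    by (metis subset_mset.add_diff_inverse subset_mset.inf_le2)
  have "size (mset D) = size ?I + size (mset D - ?I)"
    using arg_cong[OF split, of size] by (simp only: size_union)
  then have small: "size (mset D - ?I) \<le> \<kappa>"
    using assms by (auto simp: contaminated_def)
  have "filter_mset P ?I \<subseteq># filter_mset (\<lambda>p. P p \<and> p \<in> set D) (mset D')"
  proof (rule mset_subset_eqI)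
    fix p show "count (filter_mset P ?I) p \<le> count (filter_mset (\<lambda>p. P p \<and> p \<in> set D) (mset D')) p"
    proof (cases "p \<in> set D")
      case False
      then have "count (mset D) p = 0"
        by simp
      then show ?thesis
        by (simp only: count_filter_mset count_inter_mset) simp
    qed simp
  qed
  then have "size (filter_mset P ?I) \<le> size (filter_mset (\<lambda>p. P p \<and> p \<in> set D) (mset D'))"
    by (rule size_mset_mono)
  moreover have "size (filter_mset P (mset D))
      = size (filter_mset P ?I) + size (filter_mset P (mset D - ?I))"
    using arg_cong[OF split, of "\<lambda>M. size (filter_mset P M)"]
    by (simp only: filter_union_mset size_union)
  moreover have "size (filter_mset P (mset D - ?I)) \<le> size (mset D - ?I)"
    by (rule size_mset_mono) (rule multiset_filter_subset)
  ultimately show ?thesis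
    using small card_nth_eq_size_filter_mset[of D P]
      card_nth_eq_size_filter_mset[of D' "\<lambda>p. P p \<and> p \<in> set D"] by linarith
qed

lemma outlier_indicators_card_zero_le:
  assumes "\<eta> \<in> outlier_indicators m \<mu>"
  shows "real (card {i. i < m \<and> \<eta> i = 0}) \<le> \<mu> * real m"
proof -
  have "(\<Sum>i<m. \<eta> i) = (\<Sum>i<m. 1 - (if \<eta> i = 0 then 1 else 0))"
    using assms by (intro sum.cong) (auto simp: outlier_indicators_def)
  also have "\<dots> = real m - real (card {i. i < m \<and> \<eta> i = 0})"
    by (simp add: sum_subtractf sum.If_cases Int_def)
  finally show ?thesis
    using assms by (simp add: outlier_indicators_def algebra_simps)
qed

section \<open>Consequences of optimality\<close>

lemma robust_svm_optimal_class_slope: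
  assumes opt: "robust_svm_optimal H ip \<nu> \<mu> D f b \<rho> \<eta>"
    and data: "dataset m D" and "0 < m" and s: "s \<in> {1, -1}"
  defines "A \<equiv> {i. i < m \<and> \<eta> i = 1 \<and> snd (D ! i) = s}"
    and "g \<equiv> \<lambda>i. \<rho> - s * (f (fst (D ! i)) + b)"
  shows "(\<nu> - \<mu>) * real m / 2 * t \<le> (\<Sum>i\<in>A. max (g i + t) 0 - max (g i) 0)"
proof -
  define h where "h b \<rho> i = \<eta> i * max (\<rho> - snd (D ! i) * (f (fst (D ! i)) + b)) 0" for b \<rho> i
  \<comment> \<open>The two halves add up to a shift of \<open>g i\<close> by \<open>t\<close> in
    class \<open>s\<close> and cancel in the other class; \<open>f\<close> and \<open>\<eta>\<close>
    stay fixed.\<close>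
  define b' where "b' = b - s * t / 2"
  define \<rho>' where "\<rho>' = \<rho> + t / 2"
  have len: "length D = m"
    using data by (simp add: dataset_def)
  have "robust_svm_objective ip \<nu> \<mu> D f b \<rho> \<eta> \<le> robust_svm_objective ip \<nu> \<mu> D f b' \<rho>' \<eta>"
    using opt by (simp add: robust_svm_optimal_def)
  then have "(\<nu> - \<mu>) * t / 2 \<le> 1 / real m * ((\<Sum>i<m. h b' \<rho>' i) - (\<Sum>i<m. h b \<rho> i))"
    unfolding robust_svm_objective_def len h_def \<rho>'_def by (simp add: algebra_simps)
  then have "(\<nu> - \<mu>) * real m / 2 * t \<le> (\<Sum>i<m. h b' \<rho>' i - h b \<rho> i)"
    using \<open>0 < m\<close> by (simp add: sum_subtractf field_simps)
  also have "\<dots> = (\<Sum>i<m. if i \<in> A then max (g i + t) 0 - max (g i) 0 else 0)"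
  proof (rule sum.cong)
    fix i assume "i \<in> {..<m}"
    then have "\<eta> i \<in> {0, 1}" "snd (D ! i) \<in> {1, -1}" "i < m"
      using opt data by (auto simp: robust_svm_optimal_def outlier_indicators_def dataset_def)
    then show "h b' \<rho>' i - h b \<rho> i = (if i \<in> A then max (g i + t) 0 - max (g i) 0 else 0)"
      using s by (auto simp: h_def A_def g_def b'_def \<rho>'_def algebra_simps)
  qed simp
  also have "\<dots> = (\<Sum>i\<in>A. max (g i + t) 0 - max (g i) 0)"
    by (subst sum.inter_restrict[symmetric]) (auto simp: A_def intro!: sum.cong)
  finally show ?thesis .
qed

text \<open>Let m be the size of \<open>D\<close>. For the first claim, more than
  \<open>\<kappa>\<close> samples in class \<open>s\<close> have \<open>0 \<le> g i\<close>, too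
  many to be all foreign to \<open>D\<close>. For the second, class \<open>s\<close> of
  \<open>D\<close> loses at most \<open>\<kappa>\<close> samples to contamination,
  \<open>\<mu>\<close> m to \<open>\<eta> i = 0\<close> and \<open>(\<nu> - \<mu>)\<close> m / 2 to
  \<open>0 < g i\<close>; by \<open>few\<close> this does not exhaust it.\<close>

lemma contaminated_class_straddles:
  assumes opt: "robust_svm_optimal H ip \<nu> \<mu> D' f b \<rho> \<eta>"
    and cont: "D' \<in> contaminated D \<kappa>" and "0 < length D" and s: "s \<in> {1, -1}"
    and many: "2 * real \<kappa> < (\<nu> - \<mu>) * real (length D)"
    and few: "(\<nu> + \<mu>) * real (length D)
      < 2 * (real (card {i. i < length D \<and> snd (D ! i) = s}) - real \<kappa>)"
  shows "\<exists>p\<in>set D. s * (f (fst p) + b) \<le> \<rho>" and "\<exists>p\<in>set D. \<rho> \<le> s * (f (fst p) + b)"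
proof -
  let ?m = "length D"
  define g where "g i = \<rho> - s * (f (fst (D' ! i)) + b)" for i
  define A where "A = {i. i < ?m \<and> \<eta> i = 1 \<and> snd (D' ! i) = s}"
  have data: "dataset ?m D'" and len: "length D' = ?m"
    using cont by (auto simp: contaminated_def dataset_def)
  have \<eta>: "\<eta> \<in> outlier_indicators ?m \<mu>"
    using opt len by (simp add: robust_svm_optimal_def)
  have fin: "finite A"
    by (simp add: A_def)
  note slope = hinge_sum_slope_bounds[OF fin
      robust_svm_optimal_class_slope[OF opt data \<open>0 < ?m\<close> s, folded A_def g_def]]
  show "\<exists>p\<in>set D. s * (f (fst p) + b) \<le> \<rho>"
  proof (rule ccontr)
    assume "\<not> ?thesis"
    then have "{i \<in> A. 0 \<le> g i} \<subseteq> {i. i < length D' \<and> D' ! i \<notin> set D}"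
      by (auto simp: A_def g_def len)
    then have "card {i \<in> A. 0 \<le> g i} \<le> card {i. i < length D' \<and> D' ! i \<notin> set D}"
      by (rule card_mono[rotated]) simp
    then show False
      using contaminated_card_foreign_le[OF cont] slope(2) many by linarith
  qed
  show "\<exists>p\<in>set D. \<rho> \<le> s * (f (fst p) + b)"
  proof (rule ccontr)
    assume neg: "\<not> ?thesis"
    let ?C = "{i. i < length D' \<and> snd (D' ! i) = s \<and> D' ! i \<in> set D}"
    let ?Z = "{i. i < ?m \<and> \<eta> i = 0}"
    have "?C \<subseteq> ?Z \<union> {i \<in> A. 0 < g i}"
    proof
      fix i assume "i \<in> ?C"
      then show "i \<in> ?Z \<union> {i \<in> A. 0 < g i}"
        using neg \<eta> by (fastforce simp: A_def g_def len outlier_indicators_def Pi_iff)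
    qed
    then have "card ?C \<le> card (?Z \<union> {i \<in> A. 0 < g i})"
      using fin by (intro card_mono) auto
    also have "\<dots> \<le> card ?Z + card {i \<in> A. 0 < g i}"
      by (rule card_Un_le)
    finally have "card ?C \<le> card ?Z + card {i \<in> A. 0 < g i}" .
    moreover have "card {i. i < ?m \<and> snd (D ! i) = s} \<le> card ?C + \<kappa>"
      using contaminated_card_class_ge[OF cont, of "\<lambda>p. snd p = s"] by simp
    ultimately have "real (card {i. i < ?m \<and> snd (D ! i) = s})
        \<le> real (card ?Z) + real (card {i \<in> A. 0 < g i}) + real \<kappa>"
      by linarith
    then show False
      using outlier_indicators_card_zero_le[OF \<eta>] slope(1) few by (simp add: algebra_simps)
  qed
qed

lemma robust_svm_optimal_norm_le:
  assumes "rkhs H ip k" and opt: "robust_svm_optimal H ip \<nu> \<mu> D f b \<rho> \<eta>"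
  shows "(rkhs_norm ip f)\<^sup>2 \<le> 2 * (\<nu> - \<mu>) * \<rho>"
proof -
  interpret rkhs H ip k by fact
  have "ip (\<lambda>x. 0) (\<lambda>x. 0) = 0"
    using ip_scale_left[OF zero_mem zero_mem, of 0] by simp
  then have "robust_svm_objective ip \<nu> \<mu> D (\<lambda>x. 0) 0 0 \<eta> = 0"
    by (simp add: robust_svm_objective_def rkhs_norm_def)
  then have "robust_svm_objective ip \<nu> \<mu> D f b \<rho> \<eta> \<le> 0"
    using opt zero_mem by (metis robust_svm_optimal_def)
  moreover have "0 \<le> 1 / real (length D) *
      (\<Sum>i<length D. \<eta> i * max (\<rho> - snd (D ! i) * (f (fst (D ! i)) + b)) 0)"
  proof (intro mult_nonneg_nonneg sum_nonneg)
    fix i assume "i \<in> {..<length D}"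
    then have "\<eta> i \<in> {0, 1}"
      using opt by (auto simp: robust_svm_optimal_def outlier_indicators_def)
    then show "0 \<le> \<eta> i"
      by auto
  qed auto
  ultimately have "1 / 2 * (rkhs_norm ip f)\<^sup>2 - (\<nu> - \<mu>) * \<rho> \<le> 0"
    unfolding robust_svm_objective_def by linarith
  then show ?thesis
    unfolding mult.assoc by linarith
qed

section \<open>The uniform bound on the bias\<close>

theorem theorem3:
  fixes H :: "('x \<Rightarrow> real) set"
    and ip :: "('x \<Rightarrow> real) \<Rightarrow> ('x \<Rightarrow> real) \<Rightarrow> real"
    and k :: "'x \<Rightarrow> 'x \<Rightarrow> real"
    and D :: "('x \<times> real) list"
    and m l :: nat
    and \<nu> \<mu> r :: real
  assumes "rkhs H ip k"
    and "dataset m D"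
    and "r = label_ratio D"
    and "r > 0"
    and "0 < \<mu>" and "\<mu> < \<nu>" and "\<nu> < 1"
    and "\<nu> * real m \<in> \<nat>" and "\<mu> * real m \<in> \<nat>"
    and "\<mu> < r / 2"
    and "0 \<le> 2 * (\<mu> - real l / real m)"
    and "2 * (\<mu> - real l / real m) < \<nu> - \<mu>"
    and "\<nu> - \<mu> < 2 * (r - 2 * \<mu>)"
  shows "Sup {ereal \<bar>b\<bar> | b D'. D' \<in> contaminated D (nat \<lfloor>\<mu> * real m\<rfloor> - l)
                               \<and> b \<in> estimated_biases H ip \<nu> \<mu> D'} < \<infinity>"
proof -
  interpret rkhs H ip k by fact
  have len: "length D = m"
    using assms(2) by (simp add: dataset_def)
  have "0 < m"
    using assms(3,4) len by (cases "m = 0") (auto simp: label_ratio_def)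
  define \<kappa> where "\<kappa> = nat \<lfloor>\<mu> * real m\<rfloor> - l"
  \<comment> \<open>Integrality makes the floor exact; the bound on \<open>l\<close> that follows
    keeps the natural subtraction from truncating.\<close>
  have "real (nat \<lfloor>\<mu> * real m\<rfloor>) = \<mu> * real m"
    using assms(9) by (auto elim!: Nats_cases)
  moreover have "real l \<le> \<mu> * real m"
    using assms(11) \<open>0 < m\<close> by (simp add: field_simps)
  ultimately have \<kappa>: "real \<kappa> = \<mu> * real m - real l"
    unfolding \<kappa>_def by (subst of_nat_diff) linarith+
  have many: "2 * real \<kappa> < (\<nu> - \<mu>) * real m"
    using assms(12) \<open>0 < m\<close> \<kappa> by (simp add: field_simps)
  have few: "(\<nu> + \<mu>) * real m < 2 * (real (card {i. i < m \<and> snd (D ! i) = s}) - real \<kappa>)"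
    if "s \<in> {1, -1}" for s
  proof -
    have "r * real m \<le> real (card {i. i < m \<and> snd (D ! i) = s})"
      using that \<open>0 < m\<close> by (auto simp: assms(3) label_ratio_def len)
    moreover have "(\<nu> - \<mu>) * real m < 2 * (r - 2 * \<mu>) * real m"
      using assms(13) \<open>0 < m\<close> by simp
    ultimately show ?thesis
      using \<kappa> by (simp add: algebra_simps)
  qed
  \<comment> \<open>Only the finitely many samples of the original \<open>D\<close> enter, so
    \<open>K\<close> is the same for all \<open>D'\<close>. The inserted 0 gives
    \<open>0 \<le> K\<close>.\<close>
  define K where "K = Max (insert 0 ((\<lambda>p. sqrt (k (fst p) (fst p))) ` set D))"
  have K: "0 \<le> K" "\<And>p. p \<in> set D \<Longrightarrow> sqrt (k (fst p) (fst p)) \<le> K"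
    by (simp_all add: K_def)
  have bound: "\<bar>b\<bar> \<le> 2 * (\<nu> - \<mu>) * K * K"
    if D': "D' \<in> contaminated D \<kappa>" and b: "b \<in> estimated_biases H ip \<nu> \<mu> D'" for b D'
  proof -
    obtain f \<rho> \<eta> where opt: "robust_svm_optimal H ip \<nu> \<mu> D' f b \<rho> \<eta>"
      using b by (auto simp: estimated_biases_def)
    then have "f \<in> H"
      by (simp add: robust_svm_optimal_def)
    define n where "n = rkhs_norm ip f"
    have "0 \<le> n"
      using ip_nonneg[OF \<open>f \<in> H\<close>] by (simp add: n_def rkhs_norm_def)
    have f_le: "\<bar>f (fst p)\<bar> \<le> n * K" if "p \<in> set D" for p
      using abs_eval_le[OF \<open>f \<in> H\<close>, of "fst p"] mult_left_mono[OF K(2)[OF that] \<open>0 \<le> n\<close>]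
      by (simp add: n_def)
    have straddle: "\<exists>p\<in>set D. s * (f (fst p) + b) \<le> \<rho>" "\<exists>p\<in>set D. \<rho> \<le> s * (f (fst p) + b)"
      if "s \<in> {1, -1}" for s
      using contaminated_class_straddles[OF opt D' _ that] many few[OF that] \<open>0 < m\<close> len by auto
    have "b \<le> \<rho> + n * K" "\<rho> \<le> b + n * K"
      using straddle[of 1] f_le by fastforce+
    moreover have "- b \<le> \<rho> + n * K" "\<rho> \<le> - b + n * K"
      using straddle[of "-1"] f_le by fastforce+
    \<comment> \<open>Adding inequalities from opposite classes cancels \<open>\<rho>\<close> in the
      bound on \<open>\<bar>b\<bar>\<close> and \<open>b\<close> in the bound on
      \<open>\<rho>\<close>.\<close>
    ultimately have "\<bar>b\<bar> \<le> n * K" "\<rho> \<le> n * K"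
      by linarith+
    have "n * n \<le> 2 * (\<nu> - \<mu>) * \<rho>"
      using robust_svm_optimal_norm_le[OF assms(1) opt] by (simp add: n_def power2_eq_square)
    also have "\<dots> \<le> 2 * (\<nu> - \<mu>) * (n * K)"
      using \<open>\<rho> \<le> n * K\<close> assms(6) by (intro mult_left_mono) auto
    finally have "n * n \<le> n * (2 * (\<nu> - \<mu>) * K)"
      by (simp add: algebra_simps)
    then have "n \<le> 2 * (\<nu> - \<mu>) * K"
      using \<open>0 \<le> n\<close> K(1) assms(6) by (cases "n = 0") auto
    then show ?thesis
      using \<open>\<bar>b\<bar> \<le> n * K\<close> mult_right_mono[OF _ K(1)] by fastforce
  qed
  \<comment> \<open>A \<open>D'\<close> without an optimal solution contributes no bias; the bound
    also covers the supremum of the empty set.\<close>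
  have "Sup {ereal \<bar>b\<bar> | b D'. D' \<in> contaminated D \<kappa> \<and> b \<in> estimated_biases H ip \<nu> \<mu> D'}
      \<le> ereal (2 * (\<nu> - \<mu>) * K * K)"
    using bound by (auto intro!: Sup_least)
  then show ?thesis
    unfolding \<kappa>_def by (rule le_less_trans) simp
qed

end
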